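(* Let $k$ be a positive integer. Suppose $R$ is an integral domain with characteristic $\mathrm{char}(R)=0$ or $\mathrm{char}(R)>k+1$. Then there is a positive integer $N=N(k)$ (depending only on $k$) such that for any finite subset $T\subseteq R$ with $|T|\ge N$ and any $S\subseteq T$ of size $|S|\ge (24|T-T|)^{1-1/2^{k+1}}$, there exist $A,B\subseteq S$ with $|A|=|B|=2^k$ such that $$\sum_{a\in A}a^j=\sum_{b\in B}b^j\quad\text{for } j=1,\ldots,k,$$ while $$\sum_{a\in A}a^{k+1}\ne\sum_{b\in B}b^{k+1}.$$
   Context: An integral domain is a nonzero commutative ring with a multiplicative identity and no zero divisors. For a subset $T$ of a ring, $T-T=\{a-b:a,b\in T\}$. *)

theory Defs
  imports Complex_Main "HOL-Algebra.Ring"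
begin

definition characteristic :: "('a, 'm) ring_scheme \<Rightarrow> nat" where
  "characteristic R =
     (if \<exists>n::nat. n > 0 \<and> [n] \<cdot>\<^bsub>R\<^esub> \<one>\<^bsub>R\<^esub> = \<zero>\<^bsub>R\<^esub>
      then LEAST n::nat. n > 0 \<and> [n] \<cdot>\<^bsub>R\<^esub> \<one>\<^bsub>R\<^esub> = \<zero>\<^bsub>R\<^esub> else 0)"

definition difference_set :: "('a, 'm) ring_scheme \<Rightarrow> 'a set \<Rightarrow> 'a set" where
  "difference_set R T = {a \<ominus>\<^bsub>R\<^esub> b | a b. a \<in> T \<and> b \<in> T}"

definition power_sum :: "('a, 'm) ring_scheme \<Rightarrow> 'a set \<Rightarrow> nat \<Rightarrow> 'a" where
  "power_sum R A j = (\<Oplus>\<^bsub>R\<^esub>a\<in>A. a [^]\<^bsub>R\<^esub> j)"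

text \<open>The conclusion for one domain \<open>R\<close> and one candidate value \<open>N\<close> of the threshold on \<open>|T|\<close>.\<close>

definition is_threshold :: "nat \<Rightarrow> nat \<Rightarrow> ('a, 'm) ring_scheme \<Rightarrow> bool" where
  "is_threshold k N R \<longleftrightarrow>
     (\<forall>T S. T \<subseteq> carrier R \<and> finite T \<and> card T \<ge> N \<and> S \<subseteq> T \<and>
        real (card S) \<ge> (24 * real (card (difference_set R T))) powr (1 - 1 / 2 ^ (k + 1)) \<longrightarrow>
        (\<exists>A B. A \<subseteq> S \<and> B \<subseteq> S \<and> card A = 2 ^ k \<and> card B = 2 ^ k \<and>
           (\<forall>j\<in>{1..k}. power_sum R A j = power_sum R B j) \<and>
           power_sum R A (k + 1) \<noteq> power_sum R B (k + 1)))"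

text \<open>
  The theorem asserts an \<open>N\<close> that depends only on \<open>k\<close>. HOL cannot quantify over types inside a
  formula, so in \<open>\<exists>N. \<forall>R :: 'a ring. \<dots>\<close> the value \<open>N\<close> could still vary with \<open>'a\<close>.
  We therefore name the witness by a constant \<open>threshold :: nat \<Rightarrow> nat\<close> whose definition involves
  no type variable. The choice below is among the thresholds valid for all domains whose carrier is a
  set of natural numbers; up to isomorphism these are all countable domains.
  Nothing is assumed here: that a valid choice exists, and that it is also valid
  for domains with carrier in an arbitrary type, both have to be proved. The condition mentions one
  fixed type only so that the constant is independent of every type variable.
\<close>

definition threshold :: "nat \<Rightarrow> nat" where
  "threshold k = (SOME N. N > 0 \<and>
     (\<forall>R :: nat ring. domain R \<and> (characteristic R = 0 \<or> characteristic R > k + 1) \<longrightarrow>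
        is_threshold k N R))"

end

theory Submission
  imports Defs
begin

text \<open>
  The even and the odd vertices of a cube \<open>x + {0, d\<^sub>1} + \<dots> + {0, d\<^sub>n}\<close> with distinct vertices have equal
  power sums of every degree below \<open>n\<close>, while the sums of degree \<open>n\<close> differ by
  \<open>\<plusminus> n! d\<^sub>1 \<dots> d\<^sub>n\<close>, which is nonzero if the characteristic is \<open>0\<close> or exceeds \<open>n\<close>.
  A cube with \<open>n = k + 1\<close> is found in \<open>S\<close> greedily: starting from \<open>U = S\<close>, choose a difference
  \<open>d \<in> T - T\<close>, different from all differences of the vertices found so far, that is popular in \<open>U\<close>,
  and replace \<open>U\<close> by \<open>U \<inter> (U - d)\<close>. Up to a constant factor each step squares the density
  \<open>|U| / |T - T|\<close>, and the hypothesis on \<open>|S|\<close> keeps \<open>U\<close> nonempty for \<open>k + 1\<close> steps. This works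
  for every nonempty \<open>T\<close>, so every positive integer is a threshold, and it does not matter which one
  the choice operator in the definition of \<open>threshold\<close> picks.
\<close>

section \<open>Signed sums and their linearity\<close>

definition signed_sum :: "('a, 'm) ring_scheme \<Rightarrow> 'a set \<Rightarrow> 'a set \<Rightarrow> ('a \<Rightarrow> 'a) \<Rightarrow> 'a" where
  "signed_sum R E F f = finsum R f E \<ominus>\<^bsub>R\<^esub> finsum R f F"

text \<open>Even vertices \<open>E\<close> and odd vertices \<open>F\<close> of an \<open>n\<close>-dimensional cube based at \<open>\<zero>\<close>, known only
  through their moments; the condition \<open>n > 0\<close> is there because the cube of dimension \<open>0\<close> has one vertex.\<close>

definition signed_cube :: "('a, 'm) ring_scheme \<Rightarrow> nat \<Rightarrow> 'a set \<Rightarrow> 'a set \<Rightarrow> 'a \<Rightarrow> bool" where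
  "signed_cube R n E F c \<longleftrightarrow>
     finite E \<and> finite F \<and> E \<subseteq> carrier R \<and> F \<subseteq> carrier R \<and> E \<inter> F = {} \<and>
     card E + card F = 2 ^ n \<and> (n > 0 \<longrightarrow> card E = card F) \<and>
     (\<forall>x\<in>carrier R. (\<forall>j<n. signed_sum R E F (\<lambda>e. (x \<oplus>\<^bsub>R\<^esub> e) [^]\<^bsub>R\<^esub> j) = \<zero>\<^bsub>R\<^esub>) \<and>
        signed_sum R E F (\<lambda>e. (x \<oplus>\<^bsub>R\<^esub> e) [^]\<^bsub>R\<^esub> n) = c)"

context cring
begin

lemma signed_sum_closed:
  assumes "E \<subseteq> carrier R" "F \<subseteq> carrier R" "f \<in> carrier R \<rightarrow> carrier R"
  shows "signed_sum R E F f \<in> carrier R"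
proof -
  have "f \<in> E \<rightarrow> carrier R" "f \<in> F \<rightarrow> carrier R" using assms by auto
  then show ?thesis unfolding signed_sum_def by simp
qed

lemma signed_sum_cong:
  assumes "E \<subseteq> carrier R" "F \<subseteq> carrier R" "g \<in> carrier R \<rightarrow> carrier R"
    and "\<And>e. e \<in> carrier R \<Longrightarrow> f e = g e"
  shows "signed_sum R E F f = signed_sum R E F g"
proof -
  have "finsum R f E = finsum R g E" "finsum R f F = finsum R g F"
    by (rule finsum_cong'; use assms in auto)+
  then show ?thesis unfolding signed_sum_def by simp
qed

lemma signed_sum_add:
  assumes EF: "E \<subseteq> carrier R" "F \<subseteq> carrier R"
    and f: "f \<in> carrier R \<rightarrow> carrier R" and g: "g \<in> carrier R \<rightarrow> carrier R"
  shows "signed_sum R E F (\<lambda>e. f e \<oplus> g e) = signed_sum R E F f \<oplus> signed_sum R E F g"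
proof -
  have fg: "f \<in> E \<rightarrow> carrier R" "f \<in> F \<rightarrow> carrier R" "g \<in> E \<rightarrow> carrier R" "g \<in> F \<rightarrow> carrier R"
    using assms by auto
  define a b c d where "a = finsum R f E" "b = finsum R f F" "c = finsum R g E" "d = finsum R g F"
  have cl: "a \<in> carrier R" "b \<in> carrier R" "c \<in> carrier R" "d \<in> carrier R"
    using fg by (auto simp: a_b_c_d_def)
  have "(a \<oplus> c) \<ominus> (b \<oplus> d) = (a \<ominus> b) \<oplus> (c \<ominus> d)" using cl by algebra
  then show ?thesis
    unfolding signed_sum_def using fg by (simp add: a_b_c_d_def finsum_addf)
qed

lemma signed_sum_mult:
  assumes EF: "E \<subseteq> carrier R" "F \<subseteq> carrier R" "finite E" "finite F"
    and f: "f \<in> carrier R \<rightarrow> carrier R" and d: "d \<in> carrier R"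
  shows "signed_sum R E F (\<lambda>e. d \<otimes> f e) = d \<otimes> signed_sum R E F f"
proof -
  have fg: "f \<in> E \<rightarrow> carrier R" "f \<in> F \<rightarrow> carrier R"
    using assms by auto
  have cl: "finsum R f E \<in> carrier R" "finsum R f F \<in> carrier R" using fg by auto
  have "d \<otimes> (finsum R f E \<ominus> finsum R f F) = d \<otimes> finsum R f E \<ominus> d \<otimes> finsum R f F"
    using cl d by algebra
  then show ?thesis
    unfolding signed_sum_def using fg d EF by (simp add: finsum_rdistr)
qed

lemma minus_eq_zero_iff:
  assumes "u \<in> carrier R" "v \<in> carrier R"
  shows "u \<ominus> v = \<zero> \<longleftrightarrow> u = v"
proof
  have "u = (u \<ominus> v) \<oplus> v" using assms by algebra
  then show "u = v" if "u \<ominus> v = \<zero>" using that assms by simp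
qed (use assms in \<open>simp add: minus_eq r_neg\<close>)

lemma inj_on_translate: "d \<in> carrier R \<Longrightarrow> E \<subseteq> carrier R \<Longrightarrow> inj_on (\<lambda>e. e \<oplus> d) E"
  by (rule inj_onI) (auto simp: subset_iff)

text \<open>The translated copy enters with its two classes exchanged, so doubling a cube turns the
  signed sum into a finite difference of \<open>f\<close> in direction \<open>d\<close>.\<close>

lemma signed_sum_double:
  assumes EF: "E \<subseteq> carrier R" "F \<subseteq> carrier R" "finite E" "finite F"
    and f: "f \<in> carrier R \<rightarrow> carrier R" and d: "d \<in> carrier R"
    and disj: "E \<inter> (\<lambda>e. e \<oplus> d) ` F = {}" "F \<inter> (\<lambda>e. e \<oplus> d) ` E = {}"
  shows "signed_sum R (E \<union> (\<lambda>e. e \<oplus> d) ` F) (F \<union> (\<lambda>e. e \<oplus> d) ` E) f =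
    signed_sum R E F f \<ominus> signed_sum R E F (\<lambda>e. f (e \<oplus> d))"
proof -
  define g where "g = (\<lambda>e. f (e \<oplus> d))"
  have fE: "f \<in> E \<rightarrow> carrier R" "f \<in> F \<rightarrow> carrier R" "g \<in> E \<rightarrow> carrier R" "g \<in> F \<rightarrow> carrier R"
    "f \<in> (\<lambda>e. e \<oplus> d) ` E \<rightarrow> carrier R" "f \<in> (\<lambda>e. e \<oplus> d) ` F \<rightarrow> carrier R"
    using EF f d unfolding g_def by (auto simp: Pi_iff subset_iff)
  have img: "finsum R f ((\<lambda>e. e \<oplus> d) ` E) = finsum R g E"
    "finsum R f ((\<lambda>e. e \<oplus> d) ` F) = finsum R g F"
    unfolding g_def using fE inj_on_translate[OF d] EF by (auto intro!: finsum_reindex)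
  have un: "finsum R f (E \<union> (\<lambda>e. e \<oplus> d) ` F) = finsum R f E \<oplus> finsum R g F"
    "finsum R f (F \<union> (\<lambda>e. e \<oplus> d) ` E) = finsum R f F \<oplus> finsum R g E"
    using EF fE disj by (simp_all add: finsum_Un_disjoint img)
  have cl: "finsum R f E \<in> carrier R" "finsum R f F \<in> carrier R"
    "finsum R g E \<in> carrier R" "finsum R g F \<in> carrier R" using fE by auto
  have "(finsum R f E \<oplus> finsum R g F) \<ominus> (finsum R f F \<oplus> finsum R g E)
    = (finsum R f E \<ominus> finsum R f F) \<ominus> (finsum R g E \<ominus> finsum R g F)"
    using cl by algebra
  then show ?thesis unfolding signed_sum_def un g_def[symmetric] .
qed

section \<open>Moments of cubes\<close>

text \<open>Expanding one factor \<open>x \<oplus> e \<oplus> d\<close> at a time replaces the binomial theorem.\<close>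

lemma signed_cube_mixed_moment:
  assumes cube: "signed_cube R n E F c" and x: "x \<in> carrier R" and d: "d \<in> carrier R"
  defines "G \<equiv> \<lambda>a l. signed_sum R E F (\<lambda>e. (x \<oplus> e \<oplus> d) [^] (a::nat) \<otimes> (x \<oplus> e) [^] (l::nat))"
  shows "a + l < n \<Longrightarrow> G a l = \<zero>"
    and "a + l = n \<Longrightarrow> G a l = c"
    and "a + l = Suc n \<Longrightarrow> G a l = G 0 (Suc n) \<oplus> [a] \<cdot> (d \<otimes> c)"
proof -
  have EF: "E \<subseteq> carrier R" "F \<subseteq> carrier R" "finite E" "finite F"
    and c_eq: "signed_sum R E F (\<lambda>e. (x \<oplus> e) [^] n) = c"
    and low: "\<And>j. j < n \<Longrightarrow> signed_sum R E F (\<lambda>e. (x \<oplus> e) [^] j) = \<zero>"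
    using cube x unfolding signed_cube_def by auto
  have c: "c \<in> carrier R"
    unfolding c_eq[symmetric] by (rule signed_sum_closed) (use EF x in auto)
  have Gcl: "G a l \<in> carrier R" for a l
    unfolding G_def by (rule signed_sum_closed) (use EF x d in auto)
  have G0: "G 0 l = signed_sum R E F (\<lambda>e. (x \<oplus> e) [^] l)" for l
    unfolding G_def by (rule signed_sum_cong) (use EF x d in auto)
  have GS: "G (Suc a) l = G a (Suc l) \<oplus> d \<otimes> G a l" for a l
  proof -
    have eq: "(x \<oplus> e \<oplus> d) [^] Suc a \<otimes> (x \<oplus> e) [^] l =
      ((x \<oplus> e \<oplus> d) [^] a \<otimes> (x \<oplus> e) [^] Suc l) \<oplus> d \<otimes> ((x \<oplus> e \<oplus> d) [^] a \<otimes> (x \<oplus> e) [^] l)"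
      if "e \<in> carrier R" for e
    proof -
      define y p q where "y = x \<oplus> e" "p = (x \<oplus> e \<oplus> d) [^] a" "q = (x \<oplus> e) [^] l"
      have "y \<in> carrier R" "p \<in> carrier R" "q \<in> carrier R"
        using that x d by (auto simp: y_p_q_def)
      then have "p \<otimes> (y \<oplus> d) \<otimes> q = p \<otimes> (q \<otimes> y) \<oplus> d \<otimes> (p \<otimes> q)"
        using d by algebra
      then show ?thesis by (simp add: y_p_q_def)
    qed
    have "G (Suc a) l = signed_sum R E F (\<lambda>e. ((x \<oplus> e \<oplus> d) [^] a \<otimes> (x \<oplus> e) [^] Suc l)
        \<oplus> d \<otimes> ((x \<oplus> e \<oplus> d) [^] a \<otimes> (x \<oplus> e) [^] l))"
      unfolding G_def by (rule signed_sum_cong) (use EF x d eq in auto)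
    also have "\<dots> = G a (Suc l) \<oplus> signed_sum R E F (\<lambda>e. d \<otimes> ((x \<oplus> e \<oplus> d) [^] a \<otimes> (x \<oplus> e) [^] l))"
      unfolding G_def by (rule signed_sum_add) (use EF x d in auto)
    also have "signed_sum R E F (\<lambda>e. d \<otimes> ((x \<oplus> e \<oplus> d) [^] a \<otimes> (x \<oplus> e) [^] l)) = d \<otimes> G a l"
      unfolding G_def by (rule signed_sum_mult) (use EF x d in auto)
    finally show ?thesis .
  qed
  show A: "G a l = \<zero>" if "a + l < n" for a l
    using that by (induction a arbitrary: l) (use d in \<open>auto simp: GS G0 low\<close>)
  show B: "G a l = c" if "a + l = n" for a l
    using that by (induction a arbitrary: l) (use d c in \<open>auto simp: GS G0 c_eq A\<close>)
  show "G a l = G 0 (Suc n) \<oplus> [a] \<cdot> (d \<otimes> c)" if "a + l = Suc n" for a l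
    using that
  proof (induction a arbitrary: l)
    case 0
    then show ?case using Gcl by simp
  next
    \<comment> \<open>Replacing one factor \<open>x \<oplus> e \<oplus> d\<close> by
      \<open>x \<oplus> e\<close> leaves an error \<open>d\<close> times a moment of total degree
      \<open>n\<close>, which is \<open>c\<close> by \<open>B\<close>; so every replacement costs
      the same \<open>d \<otimes> c\<close>.\<close>
    case (Suc a)
    have "G (Suc a) l = G a (Suc l) \<oplus> d \<otimes> c" using Suc.prems by (simp add: GS B)
    also have "\<dots> = G 0 (Suc n) \<oplus> [a] \<cdot> (d \<otimes> c) \<oplus> d \<otimes> c"
      using Suc.IH[of "Suc l"] Suc.prems by simp
    also have "\<dots> = G 0 (Suc n) \<oplus> [Suc a] \<cdot> (d \<otimes> c)"
      using Gcl d c by (simp add: a_assoc)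
    finally show ?case .
  qed
qed

lemma signed_cube_closed:
  assumes "signed_cube R n E F c"
  shows "c \<in> carrier R"
proof -
  have EF: "E \<subseteq> carrier R" "F \<subseteq> carrier R"
    and c_eq: "signed_sum R E F (\<lambda>e. (\<zero> \<oplus> e) [^] n) = c"
    using assms unfolding signed_cube_def by auto
  show ?thesis
    unfolding c_eq[symmetric] by (rule signed_sum_closed) (use EF in auto)
qed

lemma signed_cube_0: "signed_cube R 0 {\<zero>} {} \<one>"
  by (simp add: signed_cube_def signed_sum_def minus_eq)

text \<open>As \<open>d\<close> is not a difference of old vertices, the translate misses the old
  cube. The new moment of degree \<open>j\<close> is the mixed moment with all factors unshifted
  minus the one with all factors shifted. These agree for \<open>j \<le> n\<close>; for
  \<open>j = Suc n\<close> the \<open>Suc n\<close> error terms survive.\<close>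

lemma signed_cube_Suc:
  assumes cube: "signed_cube R n E F c" and d: "d \<in> carrier R"
    and new: "d \<notin> (\<lambda>(g, h). h \<ominus> g) ` ((E \<union> F) \<times> (E \<union> F))"
  shows "signed_cube R (Suc n) (E \<union> (\<lambda>e. e \<oplus> d) ` F) (F \<union> (\<lambda>e. e \<oplus> d) ` E)
    (\<ominus> ([Suc n] \<cdot> (d \<otimes> c)))"
proof -
  have EF: "E \<subseteq> carrier R" "F \<subseteq> carrier R" "finite E" "finite F"
    and disj: "E \<inter> F = {}" and cards: "card E + card F = 2 ^ n"
    using cube unfolding signed_cube_def by auto
  have sep: "h \<noteq> g \<oplus> d" if "g \<in> E \<union> F" "h \<in> E \<union> F" for g h
  proof
    assume "h = g \<oplus> d"
    moreover have "g \<in> carrier R" using that EF by auto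
    ultimately have "h \<ominus> g = d" using d by (simp add: minus_eq a_comm[of g] a_assoc r_neg)
    then show False using new that by force
  qed
  have dj: "E \<inter> (\<lambda>e. e \<oplus> d) ` F = {}" "F \<inter> (\<lambda>e. e \<oplus> d) ` E = {}"
    "E \<inter> (\<lambda>e. e \<oplus> d) ` E = {}" "F \<inter> (\<lambda>e. e \<oplus> d) ` F = {}"
    using sep by auto
  have inj: "inj_on (\<lambda>e. e \<oplus> d) E" "inj_on (\<lambda>e. e \<oplus> d) F" "inj_on (\<lambda>e. e \<oplus> d) (E \<union> F)"
    using inj_on_translate[OF d] EF by auto
  have disj': "(\<lambda>e. e \<oplus> d) ` E \<inter> (\<lambda>e. e \<oplus> d) ` F = {}"
    using inj_on_image_Int[OF inj(3), of E F] disj by simp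
  \<comment> \<open>Each new class joins one copy of \<open>E\<close> and one of \<open>F\<close>,
    so the classes have equal size even when starting from the unbalanced cube of dimension
    0.\<close>
  have card: "card (E \<union> (\<lambda>e. e \<oplus> d) ` F) = 2 ^ n" "card (F \<union> (\<lambda>e. e \<oplus> d) ` E) = 2 ^ n"
    using EF dj cards by (simp_all add: card_Un_disjoint card_image inj)
  have moment: "signed_sum R (E \<union> (\<lambda>e. e \<oplus> d) ` F) (F \<union> (\<lambda>e. e \<oplus> d) ` E) (\<lambda>e. (x \<oplus> e) [^] j) =
      (if j \<le> n then \<zero> else \<ominus> ([Suc n] \<cdot> (d \<otimes> c)))"
    if x: "x \<in> carrier R" and j: "j \<le> Suc n" for x j
  proof -
    define G where "G = (\<lambda>a l. signed_sum R E F (\<lambda>e. (x \<oplus> e \<oplus> d) [^] (a::nat) \<otimes> (x \<oplus> e) [^] (l::nat)))"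
    have G: "a + l < n \<Longrightarrow> G a l = \<zero>" "a + l = n \<Longrightarrow> G a l = c"
      "a + l = Suc n \<Longrightarrow> G a l = G 0 (Suc n) \<oplus> [a] \<cdot> (d \<otimes> c)" for a l
      unfolding G_def using signed_cube_mixed_moment[OF cube x d] by blast+
    have Gcl: "G a l \<in> carrier R" for a l
      unfolding G_def by (rule signed_sum_closed) (use EF x d in auto)
    have c: "c \<in> carrier R" using signed_cube_closed[OF cube] .
    have "signed_sum R (E \<union> (\<lambda>e. e \<oplus> d) ` F) (F \<union> (\<lambda>e. e \<oplus> d) ` E) (\<lambda>e. (x \<oplus> e) [^] j) =
      signed_sum R E F (\<lambda>e. (x \<oplus> e) [^] j) \<ominus> signed_sum R E F (\<lambda>e. (x \<oplus> (e \<oplus> d)) [^] j)"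
      by (rule signed_sum_double) (use EF x d dj in auto)
    also have "signed_sum R E F (\<lambda>e. (x \<oplus> e) [^] j) = G 0 j"
      unfolding G_def by (rule signed_sum_cong) (use EF x d in auto)
    also have "signed_sum R E F (\<lambda>e. (x \<oplus> (e \<oplus> d)) [^] j) = G j 0"
      unfolding G_def by (rule signed_sum_cong) (use EF x d in \<open>auto simp: a_assoc\<close>)
    also have "G 0 j \<ominus> G j 0 = (if j \<le> n then \<zero> else \<ominus> ([Suc n] \<cdot> (d \<otimes> c)))"
    proof -
      consider "j < n" | "j = n" | "j = Suc n" using j by linarith
      then show ?thesis
      proof cases
        case 1
        then show ?thesis by (simp add: G(1) minus_eq)
      next
        case 2
        then show ?thesis using c by (simp add: G(2) minus_eq r_neg)
      next
        case 3
        have "[Suc n] \<cdot> (d \<otimes> c) \<in> carrier R" using d c by blast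
        moreover have "u \<ominus> (u \<oplus> v) = \<ominus> v" if "u \<in> carrier R" "v \<in> carrier R" for u v
          using that by algebra
        ultimately show ?thesis using 3 G(3)[of "Suc n" 0] Gcl by simp
      qed
    qed
    finally show ?thesis .
  qed
  show ?thesis
    unfolding signed_cube_def
  proof (intro conjI)
    show "(E \<union> (\<lambda>e. e \<oplus> d) ` F) \<inter> (F \<union> (\<lambda>e. e \<oplus> d) ` E) = {}"
      using disj dj disj' by (simp add: Int_Un_distrib Int_Un_distrib2 Int_commute)
    show "\<forall>x\<in>carrier R.
        (\<forall>j<Suc n. signed_sum R (E \<union> (\<lambda>e. e \<oplus> d) ` F) (F \<union> (\<lambda>e. e \<oplus> d) ` E)
          (\<lambda>e. (x \<oplus> e) [^] j) = \<zero>) \<and>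
        signed_sum R (E \<union> (\<lambda>e. e \<oplus> d) ` F) (F \<union> (\<lambda>e. e \<oplus> d) ` E)
          (\<lambda>e. (x \<oplus> e) [^] Suc n) = \<ominus> ([Suc n] \<cdot> (d \<otimes> c))"
    proof (intro ballI conjI allI impI)
      fix x j assume x: "x \<in> carrier R" and "j < Suc n"
      then show "signed_sum R (E \<union> (\<lambda>e. e \<oplus> d) ` F) (F \<union> (\<lambda>e. e \<oplus> d) ` E) (\<lambda>e. (x \<oplus> e) [^] j) = \<zero>"
        using moment[OF x, of j] by simp
    next
      fix x assume "x \<in> carrier R"
      then show "signed_sum R (E \<union> (\<lambda>e. e \<oplus> d) ` F) (F \<union> (\<lambda>e. e \<oplus> d) ` E) (\<lambda>e. (x \<oplus> e) [^] Suc n) =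
          \<ominus> ([Suc n] \<cdot> (d \<otimes> c))"
        using moment[OF _ order_refl] by simp
    qed
  qed (use EF d card in \<open>auto simp: subset_iff\<close>)
qed

section \<open>Popular differences\<close>

text \<open>Averaging: for each \<open>a\<close> in \<open>U\<close>, at most \<open>card X\<close>
  elements \<open>b\<close> of \<open>U\<close> have \<open>b \<ominus> a\<close> in
  \<open>X\<close>. The remaining pairs number at least \<open>card U * (card U - card X)\<close>
  and have their differences in \<open>difference_set R T\<close>, so some difference outside
  \<open>X\<close> occurs at least the average number of times.\<close>

lemma popular_difference:
  assumes T: "T \<subseteq> carrier R" "finite T" and U: "U \<subseteq> T" and X: "finite X" "card X < card U"
  shows "\<exists>d\<in>carrier R. d \<notin> X \<and>
    card U * (card U - card X) \<le> card {x \<in> U. x \<oplus> d \<in> U} * card (difference_set R T)"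
proof (rule ccontr)
  assume neg: "\<not> ?thesis"
  define Y where "Y = difference_set R T - X"
  define M where "M = card U * (card U - card X)"
  \<comment> \<open>\<open>P\<close> lists the admissible pairs by first element, \<open>Q\<close>
    lists them by difference; comparing the two is the double count.\<close>
  define P where "P = (SIGMA a:U. {b \<in> U. b \<ominus> a \<notin> X})"
  define Q where "Q = (SIGMA d:Y. {x \<in> U. x \<oplus> d \<in> U})"
  have Uc: "U \<subseteq> carrier R" and Uf: "finite U" using T U finite_subset by auto
  have diff: "difference_set R T = (\<lambda>(a, b). a \<ominus> b) ` (T \<times> T)"
    unfolding difference_set_def by auto
  have Df: "finite (difference_set R T)" unfolding diff using T by auto
  have Yc: "Y \<subseteq> carrier R" unfolding Y_def diff using T(1) by (auto simp: subset_iff)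
  have Yf: "finite Y" and Yle: "card Y \<le> card (difference_set R T)"
    unfolding Y_def using Df by (auto intro: card_mono)
  have fib: "card U - card X \<le> card {b \<in> U. b \<ominus> a \<notin> X}" if "a \<in> U" for a
  proof -
    have "inj_on (\<lambda>b. b \<ominus> a) {b \<in> U. b \<ominus> a \<in> X}"
      using inj_on_translate[of "\<ominus> a"] that Uc by (auto simp: minus_eq inj_on_def subset_iff)
    then have "card {b \<in> U. b \<ominus> a \<in> X} \<le> card X"
      by (rule card_inj_on_le) (use X in auto)
    moreover have "card U = card {b \<in> U. b \<ominus> a \<in> X} + card {b \<in> U. b \<ominus> a \<notin> X}"
      by (subst card_Un_disjoint[symmetric]) (use Uf in \<open>auto intro: arg_cong[where f=card]\<close>)
    ultimately show ?thesis by linarith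
  qed
  have "M \<le> card P"
    unfolding M_def P_def using sum_mono[of U "\<lambda>_. card U - card X", OF fib] Uf by simp
  also have "card P \<le> card Q"
  proof (rule card_inj_on_le[where f = "\<lambda>(a, b). (b \<ominus> a, a)"])
    show "inj_on (\<lambda>(a, b). (b \<ominus> a, a)) P"
      unfolding P_def inj_on_def minus_eq using Uc by (auto simp: subset_iff)
    have "a \<oplus> (b \<ominus> a) = b" if "a \<in> U" "b \<in> U" for a b
    proof -
      have "a \<in> carrier R" "b \<in> carrier R" using that Uc by auto
      then show ?thesis by algebra
    qed
    then show "(\<lambda>(a, b). (b \<ominus> a, a)) ` P \<subseteq> Q"
      unfolding P_def Q_def Y_def diff using U by auto
    show "finite Q" unfolding Q_def using Yf Uf by auto
  qed
  finally have MQ: "M \<le> (\<Sum>d\<in>Y. card {x \<in> U. x \<oplus> d \<in> U})"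
    unfolding Q_def using Yf Uf by simp
  \<comment> \<open>Positivity of \<open>M\<close> makes \<open>Y\<close> nonempty, which the strict
    inequality between sums below requires.\<close>
  have Mpos: "M > 0" unfolding M_def using X by (cases "card U") auto
  then have "Y \<noteq> {}" using MQ by auto
  have "M * card (difference_set R T) \<le>
      (\<Sum>d\<in>Y. card {x \<in> U. x \<oplus> d \<in> U} * card (difference_set R T))"
    using mult_right_mono[OF MQ] by (simp add: sum_distrib_right)
  also have "\<dots> < (\<Sum>d\<in>Y. M)"
  proof (rule sum_strict_mono)
    fix d assume "d \<in> Y"
    then have "d \<in> carrier R" "d \<notin> X" using Yc unfolding Y_def by auto
    then show "card {x \<in> U. x \<oplus> d \<in> U} * card (difference_set R T) < M"
      using neg unfolding M_def by (meson not_le)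
  qed (use Yf \<open>Y \<noteq> {}\<close> in auto)
  also have "\<dots> \<le> M * card (difference_set R T)" using Yle by simp
  finally show False by simp
qed

end

section \<open>Numerical estimate\<close>

text \<open>In the greedy construction \<open>2 * D * q ^ (2 ^ i)\<close> bounds the number of base
  points after \<open>i\<close> steps from below, and \<open>4 ^ i\<close> bounds the number of
  forbidden differences from above. The estimate thus says that at most half of the base points are
  lost to forbidden differences.\<close>

lemma power_le_scaled_tower:
  fixes D q :: real
  assumes D: "D \<ge> 1" and q: "q \<ge> 12 * (24 * D) powr (- 1 / 2 ^ (k + 1))" and i: "i \<le> k"
  shows "4 ^ i \<le> D * q ^ (2 ^ i)"
proof -
  define y where "y = ((24 * D) powr (- 1 / 2 ^ (k + 1))) ^ (2 ^ i)"
  have y0: "y > 0" unfolding y_def using D by simp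
  have "y = (24 * D) powr (- (2 ^ i / 2 ^ (k + 1)))"
    unfolding y_def using D by (simp add: powr_realpow[symmetric] powr_powr)
  also have "\<dots> \<ge> (24 * D) powr (- (1 / 2))"
  proof (rule powr_mono)
    \<comment> \<open>This is where \<open>i \<le> k\<close> enters: the exponent of
      \<open>24 * D\<close> stays at or above \<open>- (1 / 2)\<close>.\<close>
    have "(2::real) ^ i \<le> 2 ^ k" using i by simp
    then show "- (1 / 2) \<le> - (2 ^ i / 2 ^ (k + 1) :: real)" by (simp add: field_simps)
  qed (use D in auto)
  finally have "((24 * D) powr (- (1 / 2))) ^ 2 \<le> y ^ 2" by (rule power_mono) simp
  moreover have "((24 * D) powr (- (1 / 2))) ^ 2 = 1 / (24 * D)"
    using D by (simp add: powr_minus_divide powr_half_sqrt power_divide)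
  ultimately have ysq: "1 / (24 * D) \<le> y ^ 2" by simp
  have "(12 * (24 * D) powr (- 1 / 2 ^ (k + 1))) ^ (2 ^ i) \<le> q ^ (2 ^ i)"
    using q D by (intro power_mono) auto
  then have qy: "12 ^ (2 ^ i) * y \<le> q ^ (2 ^ i)" unfolding y_def power_mult_distrib .
  \<comment> \<open>Comparing squares removes the square root of \<open>24 * D\<close>; what remains
    is \<open>24 * 16 ^ i \<le> 144 ^ (2 ^ i)\<close>.\<close>
  have "4 ^ i \<le> D * (12 ^ (2 ^ i) * y)"
  proof (rule power2_le_imp_le)
    have "i + 1 \<le> 2 ^ i" by (induction i) auto
    then have "(144::real) ^ (i + 1) \<le> 144 ^ (2 ^ i)" by (intro power_increasing) auto
    moreover have "(16::real) ^ i \<le> 144 ^ i" by (intro power_mono) auto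
    moreover have "(0::real) \<le> 16 ^ i" by simp
    ultimately have big: "24 * 16 ^ i \<le> (144::real) ^ (2 ^ i)" unfolding power_add power_one_right by linarith
    have swap: "(a ^ m)\<^sup>2 = (a\<^sup>2) ^ m" for a :: real and m :: nat
      by (simp only: power_mult[symmetric] mult.commute)
    have "((4::real) ^ i)\<^sup>2 = 16 ^ i" unfolding swap by simp
    also have "\<dots> \<le> 144 ^ (2 ^ i) / 24" using big by simp
    also have "\<dots> \<le> D * (144 ^ (2 ^ i) / 24)"
      using mult_right_mono[OF D, of "144 ^ (2 ^ i) / 24"] by simp
    also have "\<dots> = D\<^sup>2 * 144 ^ (2 ^ i) * (1 / (24 * D))"
      using D by (simp add: power2_eq_square)
    also have "\<dots> \<le> D\<^sup>2 * 144 ^ (2 ^ i) * y\<^sup>2" using ysq by (intro mult_left_mono) auto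
    also have "\<dots> = (D * (12 ^ (2 ^ i) * y))\<^sup>2"
      unfolding power_mult_distrib swap[of 12] by simp
    finally show "((4::real) ^ i)\<^sup>2 \<le> (D * (12 ^ (2 ^ i) * y))\<^sup>2" .
  qed (use y0 D in auto)
  also have "\<dots> \<le> D * q ^ (2 ^ i)" using qy D by (intro mult_left_mono) auto
  finally show ?thesis .
qed

section \<open>Greedy construction of a cube and the threshold\<close>

text \<open>Without zero divisors \<open>[n] \<cdot> a = \<zero>\<close> forces
  \<open>[n] \<cdot> \<one> = \<zero>\<close>, and then the characteristic would be positive and at
  most \<open>k + 1\<close>.\<close>

lemma (in domain) nat_multiple_nonzero:
  assumes char: "characteristic R = 0 \<or> characteristic R > k + 1"
    and n: "0 < n" "n \<le> k + 1" and a: "a \<in> carrier R" "a \<noteq> \<zero>"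
  shows "[n] \<cdot> a \<noteq> \<zero>"
proof
  assume "[n] \<cdot> a = \<zero>"
  moreover have "[n] \<cdot> a = ([n] \<cdot> \<one>) \<otimes> a" using a by (simp add: add_pow_ldistr)
  ultimately have n1: "[n] \<cdot> \<one> = \<zero>" using a integral[of "[n] \<cdot> \<one>" a] by auto
  define p where "p = (\<lambda>n::nat. n > 0 \<and> [n] \<cdot> \<one> = \<zero>)"
  have "p n" unfolding p_def using n1 n by simp
  moreover have "characteristic R = (if \<exists>n. p n then LEAST n. p n else 0)"
    unfolding characteristic_def p_def ..
  ultimately have "characteristic R = (LEAST n. p n)" by auto
  moreover have "(LEAST n. p n) \<le> n" "p (LEAST n. p n)"
    using \<open>p n\<close> by (auto intro: Least_le LeastI)
  ultimately show False using char n unfolding p_def by auto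
qed

text \<open>\<open>U\<close> collects base points \<open>x\<close> whose translated cube lies in
  \<open>S\<close>. With the normalization \<open>2 * D\<close>, its guaranteed density is squared
  in each step, hence the exponent \<open>2 ^ n\<close>.\<close>

lemma (in domain) signed_cube_in_set:
  assumes char: "characteristic R = 0 \<or> characteristic R > k + 1"
    and T: "T \<subseteq> carrier R" "finite T" and S: "S \<subseteq> T"
    and D: "D = real (card (difference_set R T))" "D > 0"
    and q: "q \<ge> 0" "2 * D * q \<le> real (card S)"
    and large: "\<And>i. i \<le> k \<Longrightarrow> 4 ^ i \<le> D * q ^ (2 ^ i)"
    and n: "n \<le> k + 1"
  shows "\<exists>E F c U. signed_cube R n E F c \<and> c \<noteq> \<zero> \<and> U \<subseteq> S \<and>
    (\<forall>x\<in>U. \<forall>e\<in>E \<union> F. x \<oplus> e \<in> S) \<and> 2 * D * q ^ (2 ^ n) \<le> real (card U)"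
  using n
proof (induction n)
  case 0
  have "\<forall>x\<in>S. x \<oplus> \<zero> \<in> S" using S T by (auto simp: subset_iff)
  then show ?case
    using q signed_cube_0 by (intro exI[of _ "{\<zero>}"] exI[of _ "{}"] exI[of _ \<one>] exI[of _ S]) auto
next
  case (Suc n)
  then obtain E F c U where cube: "signed_cube R n E F c" and c: "c \<noteq> \<zero>" and U: "U \<subseteq> S"
    and US: "\<forall>x\<in>U. \<forall>e\<in>E \<union> F. x \<oplus> e \<in> S" and cU: "2 * D * q ^ (2 ^ n) \<le> real (card U)"
    by auto
  define X where "X = (\<lambda>(g, h). h \<ominus> g) ` ((E \<union> F) \<times> (E \<union> F))"
  have EF: "E \<subseteq> carrier R" "F \<subseteq> carrier R" "finite E" "finite F" "E \<inter> F = {}" "card E + card F = 2 ^ n"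
    using cube unfolding signed_cube_def by auto
  have "E \<noteq> {} \<or> F \<noteq> {}" using EF(6) by auto
  have cH: "card (E \<union> F) = 2 ^ n" using EF by (simp add: card_Un_disjoint)
  have Xf: "finite X" unfolding X_def using EF by auto
  have "card X \<le> card ((E \<union> F) \<times> (E \<union> F))" unfolding X_def using EF by (intro card_image_le) auto
  also have "\<dots> = 4 ^ n" by (simp add: card_cartesian_product cH flip: power_mult_distrib)
  finally have Xle: "card X \<le> 4 ^ n" .
  \<comment> \<open>\<open>large\<close> guarantees that \<open>X\<close> is at most half as big as
    \<open>U\<close>, so discarding forbidden differences costs only a factor 2.\<close>
  have "2 * 4 ^ n \<le> real (card U)" using large[of n] Suc.prems cU by simp
  then have "real (2 * 4 ^ n) \<le> real (card U)" by simp
  then have XU: "2 * 4 ^ n \<le> card U" using of_nat_le_iff by blast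
  have "0 < (4::nat) ^ n" by simp
  then have "card X < card U" using Xle XU by linarith
  moreover have "U \<subseteq> T" using U S by auto
  ultimately obtain d where d: "d \<in> carrier R" "d \<notin> X" and
    cd: "card U * (card U - card X) \<le> card {x \<in> U. x \<oplus> d \<in> U} * card (difference_set R T)"
    using popular_difference[OF T _ Xf, of U] by blast
  define V where "V = {x \<in> U. x \<oplus> d \<in> U}"
  have cc: "c \<in> carrier R" using signed_cube_closed[OF cube] .
  \<comment> \<open>A nonempty cube has \<open>\<zero>\<close> among its vertex differences, so
    avoiding \<open>X\<close> also forces \<open>d\<close> to be nonzero and keeps the leading
    moment nonzero.\<close>
  obtain g where "g \<in> E \<union> F" using \<open>E \<noteq> {} \<or> F \<noteq> {}\<close> by auto
  then have "g \<ominus> g \<in> X" "g \<in> carrier R" unfolding X_def using EF by force+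
  then have "\<zero> \<in> X" by (simp add: minus_eq r_neg)
  then have "d \<noteq> \<zero>" using d by auto
  then have "d \<otimes> c \<noteq> \<zero>" using d c cc integral by blast
  then have "[Suc n] \<cdot> (d \<otimes> c) \<noteq> \<zero>"
    using nat_multiple_nonzero[OF char, of "Suc n" "d \<otimes> c"] Suc.prems d cc by auto
  moreover have "[Suc n] \<cdot> (d \<otimes> c) \<in> carrier R" using d cc by blast
  ultimately have nz: "\<ominus> ([Suc n] \<cdot> (d \<otimes> c)) \<noteq> \<zero>" by (metis minus_minus minus_zero)
  have VS: "\<forall>x\<in>V. \<forall>e\<in>(E \<union> (\<lambda>e. e \<oplus> d) ` F) \<union> (F \<union> (\<lambda>e. e \<oplus> d) ` E). x \<oplus> e \<in> S"
  proof (intro ballI)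
    fix x e assume x: "x \<in> V" and e: "e \<in> (E \<union> (\<lambda>e. e \<oplus> d) ` F) \<union> (F \<union> (\<lambda>e. e \<oplus> d) ` E)"
    have xc: "x \<in> carrier R" using x U S T unfolding V_def by auto
    show "x \<oplus> e \<in> S"
    proof (cases "e \<in> E \<union> F")
      case True
      then show ?thesis using x US unfolding V_def by auto
    next
      case False
      \<comment> \<open>A vertex of the translated copy over \<open>x\<close> is an old vertex over
        \<open>x \<oplus> d\<close>, which lies in \<open>U\<close> by the choice of
        \<open>V\<close>.\<close>
      then obtain e' where e': "e' \<in> E \<union> F" "e = e' \<oplus> d" using e by auto
      then have "x \<oplus> e = (x \<oplus> d) \<oplus> e'" using xc d EF by (auto simp: a_ac subset_iff)
      then show ?thesis using x US e' unfolding V_def by auto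
    qed
  qed
  have "2 * D * q ^ (2 ^ Suc n) \<le> real (card V)"
  proof -
    \<comment> \<open>The factor 2 lost here is absorbed by the 2 in \<open>2 * D\<close>, so the
      same normalization serves every step.\<close>
    have half: "real (card U) / 2 \<le> real (card U - card X)" using Xle XU by linarith
    have "(2 * D * q ^ (2 ^ n)) * (2 * D * q ^ (2 ^ n)) \<le> real (card U) * real (card U)"
      using cU D q by (intro mult_mono) auto
    also have "\<dots> \<le> 2 * (real (card U) * real (card U - card X))"
      using mult_left_mono[OF half, of "real (card U)"] by simp
    also have "\<dots> \<le> 2 * (real (card V) * D)"
      using cd unfolding V_def D(1) of_nat_mult[symmetric] by (metis mult_left_mono of_nat_le_iff zero_le_numeral)
    finally have "(2 * D) * (2 * D * (q ^ (2 ^ n) * q ^ (2 ^ n))) \<le> (2 * D) * real (card V)"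
      by (simp only: mult_ac)
    moreover have "q ^ (2 ^ n) * q ^ (2 ^ n) = q ^ (2 ^ Suc n)"
      by (simp add: mult_2 flip: power_add)
    ultimately have "(2 * D) * (2 * D * q ^ (2 ^ Suc n)) \<le> (2 * D) * real (card V)"
      by simp
    then show ?thesis using D(2) by simp
  qed
  moreover have "V \<subseteq> S" using U unfolding V_def by auto
  ultimately show ?case
    using signed_cube_Suc[OF cube d(1) d(2)[unfolded X_def]] nz VS by blast
qed

lemma (in domain) is_threshold_pos:
  assumes char: "characteristic R = 0 \<or> characteristic R > k + 1" and N: "N > 0"
  shows "is_threshold k N R"
  unfolding is_threshold_def
proof (intro allI impI, elim conjE)
  fix T S
  assume T: "T \<subseteq> carrier R" "finite T" and NT: "N \<le> card T" and S: "S \<subseteq> T"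
    and big: "(24 * real (card (difference_set R T))) powr (1 - 1 / 2 ^ (k + 1)) \<le> real (card S)"
  define D where "D = real (card (difference_set R T))"
  have "difference_set R T = (\<lambda>(a, b). a \<ominus> b) ` (T \<times> T)"
    unfolding difference_set_def by auto
  moreover have "T \<noteq> {}" using NT N by auto
  ultimately have "card (difference_set R T) > 0" using T by (simp add: card_gt_0_iff)
  then have D1: "D \<ge> 1" unfolding D_def by simp
  \<comment> \<open>Chosen so that \<open>2 * D * q\<close> is exactly the lower bound assumed for
    \<open>card S\<close>; the 12 is half of 24.\<close>
  define q where "q = 12 * (24 * D) powr (- 1 / 2 ^ (k + 1))"
  have q0: "q > 0" unfolding q_def using D1 by simp
  have "2 * D * q = (24 * D) powr 1 * (24 * D) powr (- 1 / 2 ^ (k + 1))"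
    unfolding q_def using D1 by simp
  also have "\<dots> = (24 * D) powr (1 - 1 / 2 ^ (k + 1))"
    by (subst powr_add[symmetric]) simp
  finally have qS: "2 * D * q \<le> real (card S)" using big D_def by simp
  have large: "4 ^ i \<le> D * q ^ (2 ^ i)" if "i \<le> k" for i
    using power_le_scaled_tower[OF D1 _ that] unfolding q_def by blast
  obtain E F c U where cube: "signed_cube R (k + 1) E F c" and c: "c \<noteq> \<zero>" and U: "U \<subseteq> S"
    and US: "\<forall>x\<in>U. \<forall>e\<in>E \<union> F. x \<oplus> e \<in> S" and cU: "2 * D * q ^ (2 ^ (k + 1)) \<le> real (card U)"
    using signed_cube_in_set[OF char T S D_def _ _ qS large, of "k + 1"] D1 q0 by auto
  \<comment> \<open>After the last step a single base point suffices, so positivity is enough at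
    exponent \<open>2 ^ (k + 1)\<close>, while the estimate \<open>large\<close> stops at
    \<open>k\<close>.\<close>
  have "0 < 2 * D * q ^ (2 ^ (k + 1))" using D1 q0 by simp
  then have "real (card U) > 0" using cU by linarith
  then have "U \<noteq> {}" by auto
  then obtain x where x: "x \<in> U" by blast
  have xc: "x \<in> carrier R" using x U S T by auto
  have EF: "E \<subseteq> carrier R" "F \<subseteq> carrier R" "finite E" "finite F" "card E = 2 ^ k" "card F = 2 ^ k"
    and low: "\<And>j. j < k + 1 \<Longrightarrow> signed_sum R E F (\<lambda>e. (x \<oplus> e) [^] j) = \<zero>"
    and top: "signed_sum R E F (\<lambda>e. (x \<oplus> e) [^] (k + 1)) = c"
    using cube xc unfolding signed_cube_def by auto
  have inj: "inj_on (\<lambda>e. x \<oplus> e) H" if "H \<subseteq> carrier R" for H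
    using inj_on_translate[OF xc that] xc that by (auto simp: inj_on_def subset_iff)
  have ps: "power_sum R ((\<lambda>e. x \<oplus> e) ` H) j = finsum R (\<lambda>e. (x \<oplus> e) [^] j) H"
    if "H \<subseteq> carrier R" for H j
    unfolding power_sum_def
    by (rule finsum_reindex[OF _ inj[OF that]]) (use that xc in \<open>auto simp: subset_iff\<close>)
  have fs: "finsum R (\<lambda>e. (x \<oplus> e) [^] (j::nat)) H \<in> carrier R" if "H \<subseteq> carrier R" for H j
    using that xc by (intro finsum_closed) (auto simp: subset_iff)
  have eq: "power_sum R ((\<lambda>e. x \<oplus> e) ` E) j = power_sum R ((\<lambda>e. x \<oplus> e) ` F) j \<longleftrightarrow>
      signed_sum R E F (\<lambda>e. (x \<oplus> e) [^] j) = \<zero>" for j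
    unfolding signed_sum_def ps[OF EF(1)] ps[OF EF(2)]
    using minus_eq_zero_iff[OF fs[OF EF(1)] fs[OF EF(2)]] by blast
  show "\<exists>A B. A \<subseteq> S \<and> B \<subseteq> S \<and> card A = 2 ^ k \<and> card B = 2 ^ k \<and>
      (\<forall>j\<in>{1..k}. power_sum R A j = power_sum R B j) \<and>
      power_sum R A (k + 1) \<noteq> power_sum R B (k + 1)"
  proof (intro exI conjI)
    show "(\<lambda>e. x \<oplus> e) ` E \<subseteq> S" "(\<lambda>e. x \<oplus> e) ` F \<subseteq> S" using US x by auto
    show "card ((\<lambda>e. x \<oplus> e) ` E) = 2 ^ k" "card ((\<lambda>e. x \<oplus> e) ` F) = 2 ^ k"
      using EF inj by (simp_all add: card_image)
    show "\<forall>j\<in>{1..k}. power_sum R ((\<lambda>e. x \<oplus> e) ` E) j = power_sum R ((\<lambda>e. x \<oplus> e) ` F) j"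
      using low by (auto simp: eq)
    show "power_sum R ((\<lambda>e. x \<oplus> e) ` E) (k + 1) \<noteq> power_sum R ((\<lambda>e. x \<oplus> e) ` F) (k + 1)"
      using top c by (simp only: eq) simp
  qed
qed

text \<open>The value 1 witnesses that the choice has a candidate, so the chosen number satisfies
  the defining condition. Only its positivity is retained, since \<open>is_threshold_pos\<close>
  covers carriers of every type.\<close>

lemma threshold_pos: "threshold k > 0"
proof -
  have "\<exists>N. N > 0 \<and> (\<forall>R :: nat ring. domain R \<and> (characteristic R = 0 \<or> characteristic R > k + 1)
      \<longrightarrow> is_threshold k N R)"
    using domain.is_threshold_pos by (intro exI[of _ 1]) auto
  then show ?thesis unfolding threshold_def by (rule someI2_ex) auto
qed

theorem theorem1p2:
  fixes k :: nat
  assumes "k > 0"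
  shows "threshold k > 0 \<and>
    (\<forall>R :: ('a, 'm) ring_scheme.
       domain R \<and> (characteristic R = 0 \<or> characteristic R > k + 1) \<longrightarrow>
       is_threshold k (threshold k) R)"
  using threshold_pos domain.is_threshold_pos by blast

end
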